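(* Let $p\ge 5$ be a prime, let $r$ be a nonzero integer relatively prime to $p$, and let $0\le s\le p-1$ be an integer. If $m\in T^*(p,r,s)$, then for all integers $n\ge 0$, $$\sum_{j=0}^s \binom{s}{j}(-1)^j\,\xi_r(pn+m-j)\equiv 0 \pmod p .$$
   Context: For $n\ge 0$ let $(q;q)_n=\prod_{i=1}^n(1-q^i)$ (with $(q;q)_0=1$), and let $F(q)=\sum_{n=0}^\infty (q;q)_n$. For a nonzero integer $r$, the $r$-Fishburn numbers $\xi_r(n)\in\mathbb{Z}$ ($n\ge 0$) are defined by the formal power series identity $$\sum_{n=0}^\infty \xi_r(n)q^n = F((1-q)^r)=\sum_{n=0}^\infty\prod_{i=1}^n\left(1-(1-q)^{ri}\right),$$ where $(1-q)^{ri}$ is expanded as a formal power series in $q$ (the $n$-th summand is divisible by $q^n$, so the sum is well defined in $\mathbb{Z}[[q]]$). For a prime $p\ge5$, a nonzero integer $r$ relatively prime to $p$, and an integer $0\le s\le p-1$, define $$S^*(p,r,s)=\left\{ j : 0\le j\le p-1,\ \tfrac12 r n(3n-1)\equiv j-s \pmod p \text{ for some integer } n,\ \text{and } 24(j-s)\not\equiv -r \pmod p\right\},$$ $$T^*(p,r,s)=\left\{ k : 0\le k\le p-1 \text{ such that } k \text{ is larger than every element of } S^*(p,r,s)\right\},$$ where $j$ and $k$ range over integers. *)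

theory Defs
  imports "HOL-Computational_Algebra.Computational_Algebra" "HOL-Number_Theory.Number_Theory"
begin

definition q_fact :: "'a::comm_ring_1 \<Rightarrow> nat \<Rightarrow> 'a" where
  "q_fact q n = (\<Prod>i=1..n. 1 - q ^ i)"

text \<open>
  The series \<open>F(q) = \<Sum>n. (q;q)_n\<close> is only meaningful for arguments \<open>q\<close> at which it converges
  in the usual (X-adic) topology of formal power series, for instance \<open>q\<close> with constant term 1.
\<close>
definition kontsevich_F :: "int fps \<Rightarrow> int fps" where
  "kontsevich_F q = (\<Sum>n. q_fact q n)"

text \<open>
  \<open>(1 - X)^k\<close> for an integer exponent, over the integers. The type \<open>int\<close> has no \<open>inverse\<close>, so
  \<open>powi\<close> is not available; the inverse of \<open>1 - X\<close> is the library's one-sided inverse with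
  constant term 1.
\<close>
definition one_minus_X_powi :: "int \<Rightarrow> int fps" where
  "one_minus_X_powi k =
     (if k \<ge> 0 then (1 - fps_X) ^ nat k else fps_right_inverse (1 - fps_X) 1 ^ nat (- k))"

lemma one_minus_X_right_inverse: "(1 - fps_X) * fps_right_inverse (1 - fps_X :: int fps) 1 = 1"
  by (rule fps_right_inverse) simp

lemma one_minus_X_powi_uminus: "one_minus_X_powi k * one_minus_X_powi (- k) = 1"
proof -
  have "fps_right_inverse (1 - fps_X :: int fps) 1 * (1 - fps_X) = 1"
    using one_minus_X_right_inverse by (simp only: mult.commute)
  with one_minus_X_right_inverse show ?thesis
    unfolding one_minus_X_powi_def
    by (cases k "0::int" rule: linorder_cases) (simp_all flip: power_mult_distrib)
qed

lemma one_minus_X_powi_nth_0 [simp]: "fps_nth (one_minus_X_powi k) 0 = 1"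
  by (simp add: one_minus_X_powi_def fps_power_zeroth)

lemma q_fact_nth_eq_0:
  fixes q :: "int fps"
  assumes "fps_nth q 0 = 1" "k < n"
  shows "fps_nth (q_fact q n) k = 0"
proof -
  have "fps_X ^ n dvd q_fact q n"
  proof (induction n)
    case (Suc n)
    have "fps_nth (1 - q ^ Suc n) 0 = 0"
      using assms(1) by (simp add: fps_power_zeroth)
    then have "fps_X dvd 1 - q ^ Suc n"
      by (intro dvdI[of _ _ "fps_shift 1 (1 - q ^ Suc n)"] fps_ext)
         (simp add: fps_X_mult_nth del: power_Suc)
    with Suc show ?case
      by (simp add: q_fact_def mult_dvd_mono mult.commute)
  qed (simp add: q_fact_def)
  then obtain g where "q_fact q n = fps_X ^ n * g" ..
  with assms(2) show ?thesis by (simp add: fps_X_power_mult_nth)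
qed

lemma kontsevich_F_sums:
  assumes "fps_nth q 0 = 1"
  shows "q_fact q sums kontsevich_F q"
  and kontsevich_F_nth: "fps_nth (kontsevich_F q) k = (\<Sum>n\<le>k. fps_nth (q_fact q n) k)"
proof -
  let ?G = "Abs_fps (\<lambda>k. \<Sum>n\<le>k. fps_nth (q_fact q n) k)"
  have "q_fact q sums ?G"
    unfolding sums_def
  proof (rule tendsto_fpsI)
    fix k
    have "fps_nth (\<Sum>n<N. q_fact q n) k = fps_nth ?G k" if "N > k" for N
    proof -
      have "(\<Sum>n<N. fps_nth (q_fact q n) k) = (\<Sum>n\<le>k. fps_nth (q_fact q n) k)"
        using that q_fact_nth_eq_0[OF assms] by (intro sum.mono_neutral_right) auto
      then show ?thesis by (simp add: fps_sum_nth)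
    qed
    then show "eventually (\<lambda>N. fps_nth (\<Sum>n<N. q_fact q n) k = fps_nth ?G k) sequentially"
      using eventually_gt_at_top by (rule eventually_mono[rotated])
  qed
  moreover from this have "kontsevich_F q = ?G"
    unfolding kontsevich_F_def by (simp add: sums_iff)
  ultimately show "q_fact q sums kontsevich_F q"
    "fps_nth (kontsevich_F q) k = (\<Sum>n\<le>k. fps_nth (q_fact q n) k)" by simp_all
qed

definition fishburn :: "int \<Rightarrow> nat \<Rightarrow> int" where
  "fishburn r n = fps_nth (kontsevich_F (one_minus_X_powi r)) n"


text \<open>
  The division by 2 is exact, since \<open>n * (3 * n - 1)\<close> is always even.
\<close>
definition S_star :: "nat \<Rightarrow> int \<Rightarrow> nat \<Rightarrow> nat set" where
  "S_star p r s =
     {j. j \<le> p - 1 \<and>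
         (\<exists>n::int. [r * (n * (3 * n - 1) div 2) = int j - int s] (mod int p)) \<and>
         \<not> [24 * (int j - int s) = - r] (mod int p)}"

definition T_star :: "nat \<Rightarrow> int \<Rightarrow> nat \<Rightarrow> nat set" where
  "T_star p r s = {k. k \<le> p - 1 \<and> (\<forall>j\<in>S_star p r s. j < k)}"

text \<open>
  Always \<open>s \<in> S_star p r s\<close> (take \<open>n = 0\<close>), so that an index \<open>m - j\<close> with
  \<open>m \<in> T_star p r s\<close> and \<open>j \<le> s\<close> is never truncated.
\<close>
lemma T_star_gt:
  assumes "prime p" "coprime r (int p)" "s \<le> p - 1" "m \<in> T_star p r s"
  shows "s < m"
proof -
  have "\<not> [0 = - r] (mod int p)"
    using assms(1,2)
    by (auto simp: cong_iff_dvd_diff dest: coprime_common_divisor[of r "int p" "int p"])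
  moreover have "[r * (0 * (3 * 0 - 1) div 2) = int s - int s] (mod int p)" by simp
  ultimately have "s \<in> S_star p r s"
    using assms(3) by (auto simp: S_star_def intro!: exI[of _ 0])
  with assms(4) show ?thesis by (simp add: T_star_def)
qed

end

theory Submission
  imports Defs
begin

text \<open>
  Zagier's ``strange identity'' says that \<open>F(q) = \<Sum>n. (q;q)_n\<close> behaves near roots of unity like
  the series \<open>-1/2 \<Sum> n \<chi>(n) q^((n^2 - 1)/24)\<close>, with \<open>\<chi>\<close> the even primitive quadratic character
  modulo 12. The exponents are the pentagonal numbers. Modulo a prime the identity can be made finite and exact,
  and the congruences can then be read off from it.

  The finite version is algebra in an arbitrary integral domain. The sum
  \<open>T(x) = \<Sum>n<M. (1 - q x) \<dots> (1 - q^n x) x^n\<close> has \<open>T(1)\<close> as a partial sum of \<open>F(q)\<close>, and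
  \<open>(1 - x) T(x)\<close> satisfies a functional equation relating \<open>x\<close> to \<open>q x\<close>
  (\<open>zagier_sum_q_shift\<close>). After \<open>N\<close> steps it relates \<open>x\<close> to \<open>q^N x\<close>, and if \<open>q^N = 1\<close>
  with \<open>N\<close> odd, then \<open>q^N x\<close> is \<open>x\<close> again and \<open>T(x)\<close> reappears with the
  coefficient \<open>- x^(3N)\<close>. So \<open>(1 - x)(1 + x^(3N)) T(x)\<close> is an explicit finite sum of pentagonal powers of \<open>q\<close>, up to remainders that vanish to second
  order at \<open>x = 1\<close>. Differentiating at \<open>x = 1\<close> gives \<open>strange_identity\<close>: modulo \<open>1 - q^N\<close>, the
  sum \<open>4 F(q)\<close> is a signed sum of terms \<open>(6 \<nu> - 1) q^(\<nu>(3\<nu> - 1)/2)\<close>.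

  Now put \<open>q = (1 - X)^r\<close> and let \<open>N\<close> be a large power of \<open>p\<close>. By the Frobenius
  map \<open>1 - q^N\<close> is zero modulo \<open>(p, X^N)\<close>, so that the low coefficients of \<open>4 (1 - X)^s F(q)\<close> are,
  modulo \<open>p\<close>, those of a combination of \<open>(6 \<nu> - 1) (1 - X)^(s + r \<nu>(3\<nu> - 1)/2)\<close>. Write the last
  exponent as \<open>j + p t\<close> with \<open>0 \<le> j < p\<close>. Since \<open>24 \<nu>(3\<nu> - 1)/2 + 1 = (6 \<nu> - 1)^2\<close>, the condition
  \<open>24 (j - s) \<equiv> - r\<close> means that \<open>p\<close> divides \<open>6 \<nu> - 1\<close>, which kills the term. Otherwise \<open>j\<close> lies in
  \<open>S_star p r s\<close>, so \<open>j < m < p\<close>. The term is then \<open>(1 - X)^j\<close> times a series in \<open>X^p\<close> modulo \<open>p\<close>, and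
  its exponents have residues at most \<open>j\<close> modulo \<open>p\<close>; \<open>X^(p n + m)\<close> is not among them
  (\<open>pentagonal_term_dvd\<close>).
\<close>

section \<open>A q-difference equation for finite sums\<close>

definition zagier_sum :: "'a::comm_ring_1 \<Rightarrow> 'a \<Rightarrow> nat \<Rightarrow> 'a" where
  "zagier_sum q x M = (\<Sum>n<M. (\<Prod>i=1..n. 1 - q ^ i * x) * x ^ n)"

text \<open>
  Both sides are the product of the factors \<open>1 - q^i x\<close> for \<open>1 \<le> i \<le> n + 1\<close>.
\<close>
lemma q_prod_shift:
  fixes q x :: "'a::comm_ring_1"
  shows "(1 - q * x) * (\<Prod>i=1..n. 1 - q ^ i * (q * x)) = (\<Prod>i=1..n. 1 - q ^ i * x) * (1 - q ^ Suc n * x)"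
proof (induction n)
  case (Suc n)
  have "(1 - q * x) * (\<Prod>i=1..Suc n. 1 - q ^ i * (q * x)) =
      ((1 - q * x) * (\<Prod>i=1..n. 1 - q ^ i * (q * x))) * (1 - q ^ Suc n * (q * x))"
    by (simp add: mult.assoc)
  then show ?case
    unfolding Suc.IH by (simp add: mult_ac)
qed simp

text \<open>
  The boundary term created by truncating Zagier's series at \<open>M\<close>. If \<open>q\<close> is a root of unity, the
  product has many factors \<open>1 - x\<close>, so that the term vanishes to high order at \<open>x = 1\<close>.
\<close>
definition zagier_remainder :: "'a::comm_ring_1 \<Rightarrow> 'a \<Rightarrow> nat \<Rightarrow> 'a" where
  "zagier_remainder q x M = (\<Prod>i=1..M. 1 - q ^ i * x) * x ^ M * (q ^ (M + 1) * x ^ 2 - 1)"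

text \<open>
  For the infinite series: multiplying \<open>(qx;q)_n\<close> by \<open>1 - q^(n+1) x\<close> and shifting the
  index gives \<open>(1 - x) T(x) = 1 - q x^2 \<Sum>n. (qx;q)_n (qx)^n\<close>; pulling the factor \<open>1 - q x\<close> out of
  each term with \<open>n > 0\<close> expresses the last sum by \<open>T(q x)\<close>. The remainder is what truncation leaves
  over.
\<close>
lemma zagier_sum_q_shift:
  fixes q x :: "'a::comm_ring_1"
  shows "(1 - x) * zagier_sum q x M =
    1 - q * x ^ 2 - q ^ 2 * x ^ 3 * ((1 - q * x) * zagier_sum q (q * x) M) + zagier_remainder q x M"
proof (induction M)
  case 0
  show ?case by (simp add: zagier_sum_def zagier_remainder_def)
next
  case (Suc M)
  define c where "c = (\<Prod>i=1..M. 1 - q ^ i * x)"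
  define d where "d = (\<Prod>i=1..M. 1 - q ^ i * (q * x))"
  have cd: "(1 - q * x) * d = c * (1 - q ^ Suc M * x)"
    unfolding c_def d_def by (rule q_prod_shift)
  have 1: "zagier_sum q x (Suc M) = zagier_sum q x M + c * x ^ M"
    by (simp add: zagier_sum_def c_def)
  have 2: "zagier_sum q (q * x) (Suc M) = zagier_sum q (q * x) M + d * (q * x) ^ M"
    by (simp add: zagier_sum_def d_def)
  have 3: "zagier_remainder q x M = c * x ^ M * (q ^ (M + 1) * x ^ 2 - 1)"
    by (simp add: zagier_remainder_def c_def)
  have 4: "zagier_remainder q x (Suc M) = c * (1 - q ^ Suc M * x) * x ^ Suc M * (q ^ (M + 2) * x ^ 2 - 1)"
    by (simp add: zagier_remainder_def c_def)
  have 5: "(1 - q * x) * (B + d * (q * x) ^ M) = (1 - q * x) * B + c * (1 - q ^ Suc M * x) * (q * x) ^ M" for B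
    using cd by (simp add: distrib_left flip: mult.assoc)
  have 6: "(1 - x) * (A + c * x ^ M) = (1 - x) * A + (1 - x) * c * x ^ M" for A
    by (simp add: distrib_left mult.assoc)
  show ?case
    unfolding 1 2 4 5 6 Suc.IH 3
    by (simp add: algebra_simps power_mult_distrib power2_eq_square power3_eq_cube)
qed

text \<open>
  The pentagonal numbers \<open>0, 2, 7, 15, \<dots>\<close> of the second kind; those of the first kind
  are \<open>pent n + 2 * n + 1\<close>.
\<close>
definition pent :: "nat \<Rightarrow> nat" where "pent n = n * (3 * n + 1) div 2"

lemma pent_Suc: "pent (Suc n) = pent n + 3 * n + 2"
  by (simp add: pent_def algebra_simps)

text \<open>
  Expanding the last factor, the exponents of \<open>q\<close> at \<open>x = 1\<close> run through all pentagonal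
  numbers.
\<close>
definition partial_theta :: "'a::comm_ring_1 \<Rightarrow> 'a \<Rightarrow> nat \<Rightarrow> 'a" where
  "partial_theta q x K = (\<Sum>n<K. (-1) ^ n * x ^ (3 * n) * q ^ pent n * (1 - q ^ (2 * n + 1) * x ^ 2))"

lemma zagier_sum_iterated_shift:
  fixes q x :: "'a::comm_ring_1"
  shows "(1 - x) * zagier_sum q x M =
    partial_theta q x K
    + (-1) ^ K * x ^ (3 * K) * q ^ pent K * ((1 - q ^ K * x) * zagier_sum q (q ^ K * x) M)
    + (\<Sum>k<K. (-1) ^ k * x ^ (3 * k) * q ^ pent k * zagier_remainder q (q ^ k * x) M)"
proof (induction K)
  case 0
  show ?case by (simp add: partial_theta_def pent_def)
next
  case (Suc K)
  define c where "c = (-1) ^ K * x ^ (3 * K) * q ^ pent K"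
  define S where "S = (1 - q ^ Suc K * x) * zagier_sum q (q ^ Suc K * x) M"
  have "q * (q ^ K * x) ^ 2 = q ^ (2 * K + 1) * x ^ 2"
    "q ^ 2 * (q ^ K * x) ^ 3 = q ^ (3 * K + 2) * x ^ 3" "q * (q ^ K * x) = q ^ Suc K * x"
    by (simp_all add: power_mult_distrib power_add power2_eq_square[of q] mult_ac flip: power_mult)
  with zagier_sum_q_shift[of "q ^ K * x" q M]
  have step: "(1 - q ^ K * x) * zagier_sum q (q ^ K * x) M = 1 - q ^ (2 * K + 1) * x ^ 2
     - q ^ (3 * K + 2) * x ^ 3 * S + zagier_remainder q (q ^ K * x) M"
    unfolding S_def by (simp only:)
  have c_Suc: "(-1) ^ Suc K * x ^ (3 * Suc K) * q ^ pent (Suc K) = - (c * (q ^ (3 * K + 2) * x ^ 3))"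
    by (simp add: c_def pent_Suc power_add power_mult mult_ac)
  have theta: "partial_theta q x (Suc K) = partial_theta q x K + c * (1 - q ^ (2 * K + 1) * x ^ 2)"
    by (simp add: partial_theta_def c_def)
  show ?case
    unfolding Suc.IH theta c_Suc step lessThan_Suc S_def [symmetric] c_def [symmetric]
    by (simp add: distrib_left right_diff_distrib mult.assoc c_def)
qed

section \<open>The strange identity modulo \<open>1 - q^N\<close>\<close>

lemma pent_double: "2 * pent n = n * (3 * n + 1)"
  by (simp add: pent_def)

lemma dvd_diff_mult:
  fixes d :: "'a::comm_ring_1"
  assumes "d dvd a - a'" "d dvd b - b'"
  shows "d dvd a * b - a' * b'"
proof -
  have "a * b - a' * b' = (a - a') * b + a' * (b - b')" by (simp add: algebra_simps)
  with assms show ?thesis by simp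
qed

lemma dvd_diff_power:
  fixes d :: "'a::comm_ring_1"
  assumes "d dvd a - a'"
  shows "d dvd a ^ n - a' ^ n"
  using assms by (induction n) (simp_all add: dvd_diff_mult)

lemma dvd_diff_prod:
  fixes d :: "'a::comm_ring_1"
  assumes "\<And>i. i \<in> A \<Longrightarrow> d dvd f i - g i"
  shows "d dvd prod f A - prod g A"
  using assms by (induction A rule: infinite_finite_induct) (simp_all add: dvd_diff_mult)

lemma dvd_zagier_sum_diff:
  fixes d :: "'a::comm_ring_1"
  assumes "d dvd x - y"
  shows "d dvd zagier_sum q x M - zagier_sum q y M"
  unfolding zagier_sum_def sum_subtractf [symmetric]
proof (intro dvd_sum dvd_diff_mult dvd_diff_power dvd_diff_prod)
  fix n i
  have "1 - q ^ i * x - (1 - q ^ i * y) = - (q ^ i) * (x - y)" by (simp add: algebra_simps)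
  with assms show "d dvd 1 - q ^ i * x - (1 - q ^ i * y)" by simp
qed (rule assms)

text \<open>
  Modulo \<open>1 - q^N\<close> the points \<open>x\<close> and \<open>q^N x\<close> coincide. The number \<open>pent N\<close> is a multiple of \<open>N\<close>
  because \<open>N\<close> is odd, so its power of \<open>q\<close> disappears as well.
\<close>
lemma zagier_sum_period:
  fixes q x :: "'a::comm_ring_1"
  assumes "odd N"
  shows "1 - q ^ N dvd (1 - x) * zagier_sum q x M - q ^ pent N * ((1 - q ^ N * x) * zagier_sum q (q ^ N * x) M)"
proof -
  have x: "1 - q ^ N dvd x - q ^ N * x"
    by (rule dvdI[of _ _ x]) (simp add: algebra_simps)
  \<comment> \<open>\<open>N\<close> odd: the 2 in the denominator of \<open>pent N\<close> divides the factor \<open>3 N + 1\<close>.\<close>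
  have "even (3 * N + 1)" using assms by simp
  then obtain c where c: "3 * N + 1 = 2 * c" ..
  then have "pent N = N * c" by (simp add: pent_def)
  then have "1 - q ^ N dvd 1 - q ^ pent N"
    using dvd_diff_power[of "1 - q ^ N" 1 "q ^ N" c] by (simp add: power_mult)
  moreover have "1 - q ^ N dvd (1 - x) * zagier_sum q x M - (1 - q ^ N * x) * zagier_sum q (q ^ N * x) M"
  proof (rule dvd_diff_mult)
    have "1 - q ^ N dvd - (x - q ^ N * x)" using x by (simp only: dvd_minus_iff)
    then show "1 - q ^ N dvd 1 - x - (1 - q ^ N * x)" by (simp add: algebra_simps)
  qed (rule dvd_zagier_sum_diff [OF x])
  ultimately show ?thesis
    using dvd_diff_mult[of "1 - q ^ N" 1 "q ^ pent N"] by fastforce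
qed

text \<open>
  With \<open>2 N\<close> factors available, two of them, those with indices \<open>N - k\<close> and \<open>2 N - k\<close>, become
  \<open>1 - x\<close> modulo \<open>1 - q^N\<close>. A double zero at \<open>x = 1\<close> is what makes the remainder invisible to
  the first derivative there.
\<close>
lemma zagier_remainder_in_ideal:
  fixes q x :: "'a::comm_ring_1"
  assumes "k < N"
  shows "\<exists>g h. zagier_remainder q (q ^ k * x) (2 * N) = (1 - q ^ N) * g + (1 - x) ^ 2 * h"
proof -
  let ?f = "\<lambda>i. 1 - q ^ i * (q ^ k * x)"
  define R where "R = prod ?f ({1..2 * N} - {N - k, 2 * N - k})"
  have "prod ?f {1..2 * N} = R * prod ?f {N - k, 2 * N - k}"
    unfolding R_def by (rule prod.subset_diff) (use assms in auto)
  also have "prod ?f {N - k, 2 * N - k} = ?f (N - k) * ?f (2 * N - k)"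
    using assms by (subst prod.insert) auto
  also have "?f (N - k) = 1 - q ^ N * x"
    using assms by (simp flip: power_add mult.assoc)
  also have "?f (2 * N - k) = 1 - q ^ N * q ^ N * x"
    using assms by (simp flip: power_add mult.assoc mult_2)
  also have "(1 - q ^ N * x) * (1 - q ^ N * q ^ N * x)
      = (1 - q ^ N) * (x * (1 - q ^ N * q ^ N * x) + (1 - x) * (1 + q ^ N) * x) + (1 - x) ^ 2"
    by (simp add: algebra_simps power2_eq_square)
  finally obtain g where g: "prod ?f {1..2 * N} = R * ((1 - q ^ N) * g + (1 - x) ^ 2)"
    by blast
  define S where "S = (q ^ k * x) ^ (2 * N) * (q ^ (2 * N + 1) * (q ^ k * x) ^ 2 - 1)"
  have "zagier_remainder q (q ^ k * x) (2 * N) = (1 - q ^ N) * (R * g * S) + (1 - x) ^ 2 * (R * S)"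
    unfolding zagier_remainder_def g mult.assoc S_def[symmetric] by (simp add: algebra_simps)
  then show ?thesis by blast
qed

text \<open>
  After \<open>N\<close> steps of the functional equation the sign is \<open>(-1)^N = -1\<close>, so the sum that reappears
  on the right adds to the one on the left instead of cancelling it.
\<close>
lemma zagier_sum_mod_period:
  fixes q x :: "'a::comm_ring_1"
  assumes "odd N"
  shows "\<exists>g h. (1 - x) * (1 + x ^ (3 * N)) * zagier_sum q x (2 * N) - partial_theta q x N
    = (1 - q ^ N) * g + (1 - x) ^ 2 * h"
proof -
  obtain e f where ef: "zagier_remainder q (q ^ k * x) (2 * N) = (1 - q ^ N) * e k + (1 - x) ^ 2 * f k" if "k < N" for k
    using zagier_remainder_in_ideal[of _ N q x] by metis
  let ?c = "\<lambda>k. (-1) ^ k * x ^ (3 * k) * q ^ pent k"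
  let ?T = "zagier_sum q x (2 * N)"
  let ?T' = "q ^ pent N * ((1 - q ^ N * x) * zagier_sum q (q ^ N * x) (2 * N))"
  have err: "(\<Sum>k<N. ?c k * zagier_remainder q (q ^ k * x) (2 * N)) =
      (1 - q ^ N) * (\<Sum>k<N. ?c k * e k) + (1 - x) ^ 2 * (\<Sum>k<N. ?c k * f k)"
    unfolding sum_distrib_left sum.distrib [symmetric]
    by (intro sum.cong refl) (simp add: ef distrib_left mult.left_commute)
  obtain g where g: "(1 - x) * ?T - ?T' = (1 - q ^ N) * g"
    using zagier_sum_period[OF assms, of q x "2 * N"] by (elim dvdE)
  have "(1 - x) * ?T = partial_theta q x N - x ^ (3 * N) * ?T' + (\<Sum>k<N. ?c k * zagier_remainder q (q ^ k * x) (2 * N))"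
    using zagier_sum_iterated_shift[of x q "2 * N" N] assms by (simp add: mult.assoc)
  then have "(1 - x) * (1 + x ^ (3 * N)) * ?T - partial_theta q x N =
      x ^ (3 * N) * ((1 - x) * ?T - ?T') + (\<Sum>k<N. ?c k * zagier_remainder q (q ^ k * x) (2 * N))"
    by (simp add: algebra_simps)
  also have "\<dots> = (1 - q ^ N) * (x ^ (3 * N) * g + (\<Sum>k<N. ?c k * e k)) + (1 - x) ^ 2 * (\<Sum>k<N. ?c k * f k)"
    unfolding g err by (simp add: algebra_simps)
  finally show ?thesis by blast
qed

lemma zagier_sum_1: "zagier_sum q 1 M = (\<Sum>n<M. q_fact q n)"
  by (simp add: zagier_sum_def q_fact_def)

text \<open>
  At \<open>x = 1\<close> the pentagonal sum is all that \<open>zagier_sum_mod_period\<close> leaves.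
\<close>
lemma partial_theta_dvd:
  fixes q :: "'a::comm_ring_1"
  assumes "odd N"
  shows "1 - q ^ N dvd (\<Sum>n<N. (-1) ^ n * q ^ pent n * (1 - q ^ (2 * n + 1)))"
proof -
  obtain g h :: 'a where "- partial_theta q 1 N = (1 - q ^ N) * g"
    using zagier_sum_mod_period[OF assms, of 1 q] by auto
  then have "1 - q ^ N dvd - partial_theta q 1 N" ..
  then show ?thesis by (simp add: partial_theta_def)
qed

text \<open>
  This is \<open>zagier_sum_mod_period\<close>, read in the polynomial ring with \<open>x\<close> as indeterminate and differentiated
  at \<open>x = 1\<close>. In the first product only the derivative of \<open>1 - x\<close> contributes, and the
  factor \<open>1 + x^(3N)\<close> takes the value 2.
\<close>
lemma strange_identity_derivative:
  fixes q :: "'a::idom"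
  assumes "odd N"
  shows "1 - q ^ N dvd 2 * (\<Sum>n<2 * N. q_fact q n)
    + (\<Sum>n<N. (-1) ^ n * q ^ pent n * (of_nat (3 * n) - of_nat (3 * n + 2) * q ^ (2 * n + 1)))"
proof -
  let ?X = "[:0, 1:] :: 'a poly"
  define D where "D = (\<lambda>f :: 'a poly. poly (pderiv f) 1)"
  have D_add: "D (f + g) = D f + D g" and D_diff: "D (f - g) = D f - D g"
    and D_mult: "D (f * g) = poly f 1 * D g + poly g 1 * D f"
    and D_sum: "D (sum F A) = (\<Sum>i\<in>A. D (F i))"
    and D_const: "D [:a:] = 0"
    for f g a and F :: "nat \<Rightarrow> 'a poly" and A
    by (simp_all add: D_def pderiv_add pderiv_diff pderiv_mult poly_sum higher_pderiv_sum[of 1, simplified])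
  have D_X: "D (?X ^ n) = of_nat n" for n
    by (cases n) (simp_all add: D_def pderiv_power_Suc pderiv_pCons del: power_Suc)
  have q_power: "[:q:] ^ n = [:q ^ n:]" for n
    by (induction n) (simp_all add: mult_ac)
  obtain g h where gh: "(1 - ?X) * (1 + ?X ^ (3 * N)) * zagier_sum [:q:] ?X (2 * N) - partial_theta [:q:] ?X N
    = (1 - [:q:] ^ N) * g + (1 - ?X) ^ 2 * h"
    using zagier_sum_mod_period[OF assms, of ?X "[:q:]"] by blast
  have 1: "D (1 - ?X) = -1" using D_X[of 1] by (simp add: D_diff) (simp add: D_def)
  have "poly (zagier_sum [:q:] ?X (2 * N)) 1 = zagier_sum q 1 (2 * N)"
    by (simp add: zagier_sum_def poly_sum poly_prod)
  then have "D ((1 - ?X) * (1 + ?X ^ (3 * N)) * zagier_sum [:q:] ?X (2 * N)) = - 2 * (\<Sum>n<2 * N. q_fact q n)"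
    by (simp add: D_mult 1 zagier_sum_1)
  moreover have "D ((1 - [:q:] ^ N) * g + (1 - ?X) ^ 2 * h) = (1 - q ^ N) * D g"
    by (simp add: D_mult D_add D_diff q_power D_const power2_eq_square) (simp add: D_def)
  moreover have "D (partial_theta [:q:] ?X N) =
     (\<Sum>n<N. (-1) ^ n * q ^ pent n * (of_nat (3 * n) - of_nat (3 * n + 2) * q ^ (2 * n + 1)))"
    unfolding partial_theta_def D_sum
  proof (rule sum.cong)
    fix n
    have *: "(- 1 :: 'a poly) ^ n = [:(-1) ^ n:]"
      by (induction n) (simp_all add: one_pCons)
    have **: "D 1 = 0" by (simp add: D_def)
    show "D ((- 1) ^ n * ?X ^ (3 * n) * [:q:] ^ pent n * (1 - [:q:] ^ (2 * n + 1) * ?X\<^sup>2)) =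
       (-1) ^ n * q ^ pent n * (of_nat (3 * n) - of_nat (3 * n + 2) * q ^ (2 * n + 1))"
      unfolding * q_power D_mult D_diff D_X D_const **
      by (simp add: algebra_simps)
  qed simp
  ultimately have "- 2 * (\<Sum>n<2 * N. q_fact q n) -
     (\<Sum>n<N. (-1) ^ n * q ^ pent n * (of_nat (3 * n) - of_nat (3 * n + 2) * q ^ (2 * n + 1))) = (1 - q ^ N) * D g"
    using arg_cong[OF gh, of D] by (simp only: D_diff)
  then have "1 - q ^ N dvd - (2 * (\<Sum>n<2 * N. q_fact q n) +
     (\<Sum>n<N. (-1) ^ n * q ^ pent n * (of_nat (3 * n) - of_nat (3 * n + 2) * q ^ (2 * n + 1))))"
    by (metis (no_types, lifting) diff_conv_add_uminus dvd_triv_left minus_add_distrib mult_minus_left)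
  then show ?thesis by (simp only: dvd_minus_iff)
qed

text \<open>
  The symmetric form, in which each coefficient is up to sign \<open>6 \<nu> - 1\<close> for the exponent
  \<open>\<nu>(3\<nu> - 1)/2\<close>: the index \<open>\<nu>\<close> is \<open>- n\<close> for the first and \<open>n + 1\<close> for the second term.
  As \<open>(6 \<nu> - 1)^2 = 24 \<nu>(3\<nu> - 1)/2 + 1\<close>, a prime divides the coefficient exactly when
  it divides \<open>24 e + 1\<close> for the exponent \<open>e\<close>.
\<close>
theorem strange_identity:
  fixes q :: "'a::idom"
  assumes "odd N"
  shows "1 - q ^ N dvd 4 * (\<Sum>n<2 * N. q_fact q n)
    + (\<Sum>n<N. (-1) ^ n * q ^ pent n * (of_nat (6 * n + 1) - of_nat (6 * n + 5) * q ^ (2 * n + 1)))"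
proof -
  have "1 - q ^ N dvd 2 * (2 * (\<Sum>n<2 * N. q_fact q n)
    + (\<Sum>n<N. (-1) ^ n * q ^ pent n * (of_nat (3 * n) - of_nat (3 * n + 2) * q ^ (2 * n + 1))))
    + (\<Sum>n<N. (-1) ^ n * q ^ pent n * (1 - q ^ (2 * n + 1)))"
    by (intro dvd_add dvd_mult strange_identity_derivative partial_theta_dvd assms)
  also have "\<dots> = 4 * (\<Sum>n<2 * N. q_fact q n)
    + (\<Sum>n<N. (-1) ^ n * q ^ pent n * (of_nat (6 * n + 1) - of_nat (6 * n + 5) * q ^ (2 * n + 1)))"
    by (simp add: sum_distrib_left algebra_simps flip: sum.distrib)
  finally show ?thesis .
qed

section \<open>Powers of \<open>1 - X\<close> modulo a prime\<close>

lemma prime_dvd_prime_power_choose: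
  assumes "prime p" "0 < k" "k < p ^ a"
  shows "p dvd (p ^ a choose k)"
proof (rule ccontr)
  assume "\<not> p dvd (p ^ a choose k)"
  with assms(1) have "coprime (p ^ a) (p ^ a choose k)"
    by (simp add: prime_imp_coprime)
  moreover have "p ^ a dvd k * (p ^ a choose k)"
    using assms(2) by (simp add: times_binomial_minus1_eq)
  ultimately have "p ^ a dvd k"
    by (simp add: coprime_dvd_mult_left_iff)
  with assms(2,3) show False by (auto dest: dvd_imp_le)
qed

lemma fps_nth_one_minus_X_power:
  "fps_nth ((1 - fps_X) ^ n) k = (-1) ^ k * (of_nat (n choose k) :: 'a::comm_ring_1)"
proof (induction n arbitrary: k)
  case (Suc n)
  have "(1 - fps_X) ^ Suc n = (1 - fps_X) ^ n - fps_X * (1 - fps_X :: 'a fps) ^ n"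
    by (simp add: algebra_simps)
  then show ?case
    by (cases k) (simp_all add: Suc.IH algebra_simps)
qed (simp split: if_splits add: binomial_eq_0)

text \<open>
  Membership in the ideal \<open>(p, X^N)\<close> of the power series over the integers.
\<close>
definition zero_mod :: "nat \<Rightarrow> nat \<Rightarrow> int fps \<Rightarrow> bool" where
  "zero_mod p N f \<longleftrightarrow> (\<forall>k<N. int p dvd fps_nth f k)"

lemma zero_mod_mult: "zero_mod p N f \<Longrightarrow> zero_mod p N (f * g)"
  unfolding zero_mod_def fps_mult_nth by (auto intro!: dvd_sum dvd_mult2)

lemma one_minus_X_powi_of_nat: "one_minus_X_powi (int n) = (1 - fps_X) ^ n"
  by (simp add: one_minus_X_powi_def)

lemma one_minus_X_powi_add_1: "one_minus_X_powi (k + 1) = one_minus_X_powi k * (1 - fps_X)"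
proof (cases "k \<ge> 0")
  case True
  then show ?thesis by (simp add: one_minus_X_powi_def nat_add_distrib mult.commute)
next
  case False
  then obtain n where "nat (- k) = Suc n"
    by (cases "nat (- k)") auto
  then have n: "k = - int (Suc n)" by simp
  let ?v = "fps_right_inverse (1 - fps_X :: int fps) 1"
  have neg: "one_minus_X_powi (- int l) = ?v ^ l" for l
    by (cases "l = 0") (simp_all add: one_minus_X_powi_def)
  have "?v ^ Suc n * (1 - fps_X) = ?v ^ n * ((1 - fps_X) * ?v)"
    by (simp add: mult_ac)
  also have "\<dots> = ?v ^ n"
    by (simp only: one_minus_X_right_inverse mult_1_right)
  finally have "one_minus_X_powi k * (1 - fps_X) = one_minus_X_powi (- int n)"
    by (simp only: n neg)
  then show ?thesis by (simp add: n)
qed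

lemma one_minus_X_powi_add:
  "one_minus_X_powi (k + l) = one_minus_X_powi k * one_minus_X_powi l"
proof -
  have nat: "one_minus_X_powi (k + int n) = one_minus_X_powi k * (1 - fps_X) ^ n" for k n
    by (induction n) (simp_all add: one_minus_X_powi_add_1 mult_ac flip: add.assoc add: add.commute[of 1])
  show ?thesis
  proof (cases "l \<ge> 0")
    case True
    then show ?thesis using nat[of k "nat l"] by (simp add: one_minus_X_powi_def)
  next
    case False
    have "one_minus_X_powi k = one_minus_X_powi (k + l) * one_minus_X_powi (- l)"
      using nat[of "k + l" "nat (- l)"] False by (simp add: one_minus_X_powi_def)
    then have "one_minus_X_powi k * one_minus_X_powi l =
        one_minus_X_powi (k + l) * (one_minus_X_powi l * one_minus_X_powi (- l))"
      by (simp add: mult_ac)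
    then show ?thesis by (simp add: one_minus_X_powi_uminus)
  qed
qed

lemma one_minus_X_powi_0: "one_minus_X_powi 0 = 1"
  by (simp add: one_minus_X_powi_def)

lemma one_minus_X_powi_power: "one_minus_X_powi k ^ n = one_minus_X_powi (int n * k)"
  by (induction n) (simp_all add: one_minus_X_powi_0 one_minus_X_powi_add distrib_right)

text \<open>
  Modulo \<open>p\<close>, the \<open>p^a\<close>-th power of \<open>1 - X\<close> is \<open>1 - X^(p^a)\<close>, hence \<open>1\<close> modulo \<open>(p, X^(p^a))\<close>.
  Powers and inverses of elements that are \<open>1\<close> modulo an ideal have the same property.
\<close>
lemma one_minus_X_powi_frobenius:
  assumes "prime p"
  shows "zero_mod p (p ^ a) (1 - one_minus_X_powi r ^ (p ^ a))"
proof -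
  let ?N = "p ^ a"
  have 1: "zero_mod p ?N (1 - (1 - fps_X) ^ ?N)"
    unfolding zero_mod_def
  proof (intro allI impI)
    fix k assume "k < ?N"
    with assms show "int p dvd fps_nth (1 - (1 - fps_X) ^ ?N) k"
      by (cases "k = 0") (auto simp: fps_nth_one_minus_X_power prime_dvd_prime_power_choose)
  qed
  have nat: "zero_mod p ?N (1 - one_minus_X_powi (int t) ^ ?N)" for t
  proof -
    have "1 - (1 - fps_X) ^ ?N dvd 1 - ((1 - fps_X :: int fps) ^ ?N) ^ t"
      using dvd_diff_power[of "1 - (1 - fps_X) ^ ?N" 1 "(1 - fps_X) ^ ?N" t] by simp
    then obtain g where "1 - ((1 - fps_X :: int fps) ^ ?N) ^ t = (1 - (1 - fps_X) ^ ?N) * g" ..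
    with zero_mod_mult[OF 1, of g] show ?thesis
      by (simp add: one_minus_X_powi_of_nat mult.commute flip: power_mult)
  qed
  show ?thesis
  proof (cases "r \<ge> 0")
    case True
    then show ?thesis using nat[of "nat r"] by simp
  next
    case False
    let ?A = "one_minus_X_powi r ^ ?N" and ?B = "one_minus_X_powi (- r) ^ ?N"
    have "?A * ?B = 1"
      by (simp add: one_minus_X_powi_uminus flip: power_mult_distrib)
    then have "1 - ?A = (1 - ?B) * (- ?A)" by (simp add: algebra_simps)
    with False show ?thesis using zero_mod_mult[OF nat[of "nat (- r)"], of "- ?A"] by simp
  qed
qed

text \<open>
  A \<open>p\<close>-th power is modulo \<open>p\<close> a series in \<open>X^p\<close>. Such series form a ring that contains
  the inverses of its elements with constant term 1.
\<close>
lemma one_minus_X_powi_frobenius_nth: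
  assumes "prime p" "\<not> p dvd k"
  shows "int p dvd fps_nth (one_minus_X_powi (int p * t)) k"
proof -
  let ?H = "\<lambda>f :: int fps. \<forall>k. \<not> p dvd k \<longrightarrow> int p dvd fps_nth f k"
  have mult: "?H (f * g)" if "?H f" "?H g" for f g
  proof (intro allI impI)
    fix k assume k: "\<not> p dvd k"
    have "int p dvd fps_nth f i * fps_nth g (k - i)" if "i \<le> k" for i
    proof (cases "p dvd i")
      case True
      with k that have "\<not> p dvd k - i" by (metis dvd_diffD)
      with \<open>?H g\<close> show ?thesis by (simp add: dvd_mult)
    qed (use \<open>?H f\<close> in \<open>simp add: dvd_mult2\<close>)
    then show "int p dvd fps_nth (f * g) k"
      unfolding fps_mult_nth by (intro dvd_sum) simp
  qed
  have p: "?H ((1 - fps_X) ^ p)"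
  proof (intro allI impI)
    fix k assume k: "\<not> p dvd k"
    then have "p dvd (p choose k)"
    proof (cases "k < p")
      case True
      with k show ?thesis using prime_dvd_prime_power_choose[OF assms(1), of k 1] by (cases "k = 0") auto
    next
      case False
      with k have "p < k" by (cases "k = p") auto
      then show ?thesis by (simp add: binomial_eq_0)
    qed
    then show "int p dvd fps_nth ((1 - fps_X) ^ p) k"
      by (simp add: fps_nth_one_minus_X_power)
  qed
  have nat: "?H (one_minus_X_powi (int p * int n))" for n
  proof (induction n)
    case 0
    show ?case by (auto simp: one_minus_X_powi_0)
  next
    case (Suc n)
    have "one_minus_X_powi (int p * int (Suc n)) = one_minus_X_powi (int p * int n) * (1 - fps_X) ^ p"
      by (simp add: one_minus_X_powi_of_nat distrib_left mult.commute flip: one_minus_X_powi_add)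
        (simp add: one_minus_X_powi_add one_minus_X_powi_of_nat mult.commute)
    with mult[OF Suc.IH p] show ?case by simp
  qed
  show ?thesis
  proof (cases "t \<ge> 0")
    case True
    with nat[of "nat t"] assms(2) show ?thesis by simp
  next
    case False
    define f where "f = one_minus_X_powi (int p * - t)"
    define g where "g = one_minus_X_powi (int p * t)"
    have f: "?H f" using nat[of "nat (- t)"] False by (simp add: f_def)
    have fg: "f * g = 1"
      using one_minus_X_powi_uminus[of "int p * t"] by (simp add: f_def g_def mult.commute)
    have "int p dvd fps_nth g k" if "\<not> p dvd k" for k
      using that
    proof (induction k rule: less_induct)
      case (less k)
      \<comment> \<open>Solve \<open>f g = 1\<close> for the coefficient of \<open>X^k\<close> in \<open>g\<close>; in each product one index is prime to \<open>p\<close>.\<close>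
      have "k > 0" using less.prems by (cases k) auto
      then have "0 = fps_nth (f * g) k" by (simp add: fg)
      also have "\<dots> = fps_nth g k + (\<Sum>i=1..k. fps_nth f i * fps_nth g (k - i))"
        by (simp add: fps_mult_nth sum.atLeast_Suc_atMost f_def)
      finally have "fps_nth g k = - (\<Sum>i=1..k. fps_nth f i * fps_nth g (k - i))" by simp
      moreover have "int p dvd (\<Sum>i=1..k. fps_nth f i * fps_nth g (k - i))"
      proof (rule dvd_sum)
        fix i assume i: "i \<in> {1..k}"
        show "int p dvd fps_nth f i * fps_nth g (k - i)"
        proof (cases "p dvd i")
          case True
          with less.prems i have "\<not> p dvd k - i" by (metis dvd_diffD atLeastAtMost_iff)
          moreover have "k - i < k" using i \<open>k > 0\<close> by simp
          ultimately show ?thesis using less.IH by (simp add: dvd_mult)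
        qed (use f in \<open>simp add: dvd_mult2\<close>)
      qed
      ultimately show ?case by simp
    qed
    with assms(2) show ?thesis by (simp add: g_def)
  qed
qed

section \<open>The congruence\<close>

text \<open>
  Here both conditions in the definition of \<open>S_star\<close> are used: the representation by a
  pentagonal number holds for the exponent at hand, and the excluded residue class is the one in which
  the factor \<open>6 \<nu> - 1\<close> is already divisible by \<open>p\<close>.
\<close>
lemma pentagonal_term_dvd:
  fixes \<nu> r :: int
  assumes "prime p" "coprime r (int p)" "m \<in> T_star p r s"
  shows "int p dvd (6 * \<nu> - 1) * fps_nth (one_minus_X_powi (int s + r * (\<nu> * (3 * \<nu> - 1) div 2))) (p * n + m)"
proof (cases "int p dvd 6 * \<nu> - 1")
  case False
  define e where "e = \<nu> * (3 * \<nu> - 1) div 2"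
  define z where "z = int s + r * e"
  define j where "j = nat (z mod int p)"
  have "p > 0" using assms(1) by (simp add: prime_gt_0_nat)
  then have j: "int j = z mod int p" "j < p"
    by (simp_all add: j_def nat_less_iff)
  have cong: "[r * e = int j - int s] (mod int p)"
    by (simp add: cong_def j(1) z_def mod_simps)
  have "even (\<nu> * (3 * \<nu> - 1))" by simp
  then have e: "2 * e = \<nu> * (3 * \<nu> - 1)" by (simp add: e_def)
  have "\<not> [24 * (int j - int s) = - r] (mod int p)"
  proof
    assume "[24 * (int j - int s) = - r] (mod int p)"
    with cong have "[24 * (r * e) = - r] (mod int p)"
      using cong_scalar_left cong_trans by blast
    then have "int p dvd 24 * (r * e) + r" by (simp add: cong_iff_dvd_diff)
    also have "24 * (r * e) + r = r * (12 * (2 * e) + 1)" by (simp add: algebra_simps)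
    also have "\<dots> = r * (6 * \<nu> - 1) ^ 2"
      unfolding e by (simp add: algebra_simps power2_eq_square)
    finally have "int p dvd (6 * \<nu> - 1) ^ 2"
      using assms(2) by (simp add: coprime_dvd_mult_right_iff coprime_commute)
    with assms(1) have "int p dvd 6 * \<nu> - 1"
      using prime_dvd_power[of "int p" "6 * \<nu> - 1" 2] by simp
    with False show False ..
  qed
  with cong j(2) have "j \<in> S_star p r s" by (auto simp: S_star_def e_def)
  with assms(3) have m: "j < m" "m < p"
    using \<open>p > 0\<close> by (auto simp: T_star_def)
  have "one_minus_X_powi z = one_minus_X_powi (int j) * one_minus_X_powi (int p * (z div int p))"
    by (simp add: j(1) flip: one_minus_X_powi_add)
  then have "fps_nth (one_minus_X_powi z) (p * n + m) =
     (\<Sum>i=0..p * n + m. (-1) ^ i * int (j choose i) * fps_nth (one_minus_X_powi (int p * (z div int p))) (p * n + m - i))"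
    by (simp add: one_minus_X_powi_of_nat fps_mult_nth fps_nth_one_minus_X_power)
  also have "int p dvd \<dots>"
  proof (rule dvd_sum)
    fix i assume "i \<in> {0..p * n + m}"
    show "int p dvd (-1) ^ i * int (j choose i) * fps_nth (one_minus_X_powi (int p * (z div int p))) (p * n + m - i)"
    proof (cases "i \<le> j")
      case True
      with m have eq: "p * n + m - i = p * n + (m - i)" and "0 < m - i" "m - i < p" by auto
      then have "\<not> p dvd p * n + m - i"
        unfolding eq by (subst dvd_add_right_iff) (simp_all add: nat_dvd_not_less)
      with assms(1) show ?thesis by (intro dvd_mult one_minus_X_powi_frobenius_nth)
    qed (simp add: binomial_eq_0)
  qed
  finally show ?thesis by (simp add: z_def e_def)
qed simp

text \<open>
  The sum is the coefficient of \<open>X^(p n + m)\<close> in \<open>(1 - X)^s F((1 - X)^r)\<close>. Any power of \<open>p\<close>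
  beyond this exponent serves as \<open>N\<close>.
\<close>
theorem theorem1p3:
  fixes p s m n :: nat and r :: int
  assumes "prime p" and "p \<ge> 5"
    and "r \<noteq> 0" and "coprime r (int p)"
    and "s \<le> p - 1"
    and "m \<in> T_star p r s"
  shows "[(\<Sum>j=0..s. int (s choose j) * (-1) ^ j * fishburn r (p * n + m - j)) = 0] (mod int p)"
proof -
  define K where "K = p * n + m"
  define N where "N = p ^ K"
  define q where "q = one_minus_X_powi r"
  have "s < m" using T_star_gt assms by blast
  then have sK: "s \<le> K" by (simp add: K_def)
  have KN: "K < N" unfolding N_def using assms(2) by (intro power_gt_expt) simp
  have "odd p" using assms(1,2) by (simp add: prime_odd_nat)
  then have "odd N" by (simp add: N_def)
  define A where "A = (\<Sum>i<2 * N. q_fact q i)"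
  define B where "B = (\<Sum>i<N. (-1) ^ i * q ^ pent i * (of_nat (6 * i + 1) - of_nat (6 * i + 5) * q ^ (2 * i + 1)))"
  obtain g where "4 * A + B = (1 - q ^ N) * g"
    using strange_identity[OF \<open>odd N\<close>, of q] unfolding A_def B_def by (elim dvdE)
  then have "(1 - fps_X) ^ s * (4 * A + B) = (1 - q ^ N) * (g * (1 - fps_X) ^ s)"
    by (simp add: mult_ac)
  moreover have "zero_mod p N ((1 - q ^ N) * (g * (1 - fps_X) ^ s))"
    unfolding q_def N_def by (intro zero_mod_mult one_minus_X_powi_frobenius assms)
  ultimately have "zero_mod p N ((1 - fps_X) ^ s * (4 * A + B))"
    by (simp only:)
  with KN have "int p dvd fps_nth ((1 - fps_X) ^ s * (4 * A + B)) K"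
    by (simp add: zero_mod_def)
  then have AB: "int p dvd 4 * fps_nth ((1 - fps_X) ^ s * A) K + fps_nth ((1 - fps_X) ^ s * B) K"
    by (simp add: distrib_left mult.left_commute[of _ "fps_const 4"] numeral_fps_const)
  have B: "(1 - fps_X) ^ s * B = (\<Sum>i<N. (-1) ^ i *
      (of_nat (6 * i + 1) * one_minus_X_powi (int s + r * int (pent i))
       - of_nat (6 * i + 5) * one_minus_X_powi (int s + r * int (pent i + 2 * i + 1))))"
    unfolding B_def sum_distrib_left
  proof (rule sum.cong)
    fix i
    have "(1 - fps_X) ^ s * q ^ l = one_minus_X_powi (int s + r * int l)" for l
      by (simp add: q_def one_minus_X_powi_power one_minus_X_powi_add one_minus_X_powi_of_nat mult.commute)
    note L = this[of "pent i"] this[of "pent i + 2 * i + 1"]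
    show "(1 - fps_X) ^ s * ((- 1) ^ i * q ^ pent i * (of_nat (6 * i + 1) - of_nat (6 * i + 5) * q ^ (2 * i + 1))) =
      (-1) ^ i * (of_nat (6 * i + 1) * one_minus_X_powi (int s + r * int (pent i))
       - of_nat (6 * i + 5) * one_minus_X_powi (int s + r * int (pent i + 2 * i + 1)))"
      unfolding L [symmetric] by (simp add: algebra_simps power_add)
  qed simp
  have "fps_nth ((1 - fps_X) ^ s * B) K = (\<Sum>i<N. (-1) ^ i *
      (int (6 * i + 1) * fps_nth (one_minus_X_powi (int s + r * int (pent i))) K
       - int (6 * i + 5) * fps_nth (one_minus_X_powi (int s + r * int (pent i + 2 * i + 1))) K))"
  proof -
    have sign: "fps_nth ((-1) ^ i * f) K = (-1) ^ i * fps_nth f K" for i and f :: "int fps"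
      by (cases "even i") simp_all
    show ?thesis
      unfolding B by (simp only: fps_sum_nth fps_sub_nth sign fps_mult_of_nat_nth)
  qed
  also have "int p dvd \<dots>"
  proof (rule dvd_sum, rule dvd_mult, rule dvd_diff)
    fix i :: nat
    have two: "2 * int (pent i) = int i * (3 * int i + 1)"
      using arg_cong[OF pent_double[of i], of int] by (simp add: algebra_simps)
    have "(- int i) * (3 * (- int i) - 1) = 2 * int (pent i)"
      using two by (simp add: algebra_simps)
    then have "(- int i) * (3 * (- int i) - 1) div 2 = int (pent i)"
      by (simp only: nonzero_mult_div_cancel_left)
    moreover have "6 * (- int i) - 1 = - int (6 * i + 1)" by simp
    ultimately show "int p dvd int (6 * i + 1) * fps_nth (one_minus_X_powi (int s + r * int (pent i))) K"
      using pentagonal_term_dvd[OF assms(1,4,6), of "- int i" n] unfolding K_def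
      by (simp only: mult_minus_left dvd_minus_iff)
    have "(int i + 1) * (3 * (int i + 1) - 1) = 2 * int (pent i + 2 * i + 1)"
      using two by (simp add: algebra_simps)
    then have "(int i + 1) * (3 * (int i + 1) - 1) div 2 = int (pent i + 2 * i + 1)"
      by (simp only: nonzero_mult_div_cancel_left)
    moreover have "int (6 * i + 5) = 6 * (int i + 1) - 1" by simp
    ultimately show "int p dvd int (6 * i + 5) * fps_nth (one_minus_X_powi (int s + r * int (pent i + 2 * i + 1))) K"
      using pentagonal_term_dvd[OF assms(1,4,6), of "int i + 1" n] unfolding K_def by (simp only:)
  qed
  finally have "int p dvd 4 * fps_nth ((1 - fps_X) ^ s * A) K"
    using AB by (simp add: dvd_add_left_iff)
  moreover have "\<not> int p dvd 4"
  proof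
    assume "int p dvd 4"
    then have "int p \<le> 4" by (rule zdvd_imp_le) simp
    with assms(2) show False by simp
  qed
  ultimately have "int p dvd fps_nth ((1 - fps_X) ^ s * A) K"
    using assms(1) by (simp add: prime_dvd_mult_iff)
  also have "fps_nth ((1 - fps_X) ^ s * A) K = (\<Sum>j=0..K. (-1) ^ j * int (s choose j) * fps_nth A (K - j))"
    by (simp add: fps_mult_nth fps_nth_one_minus_X_power)
  also have "\<dots> = (\<Sum>j=0..s. (-1) ^ j * int (s choose j) * fps_nth A (K - j))"
    using sK by (intro sum.mono_neutral_right) (auto simp: binomial_eq_0)
  also have "\<dots> = (\<Sum>j=0..s. int (s choose j) * (-1) ^ j * fishburn r (K - j))"
  proof (rule sum.cong)
    fix j
    have q0: "fps_nth q 0 = 1" by (simp add: q_def)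
    have "fps_nth A (K - j) = (\<Sum>i<2 * N. fps_nth (q_fact q i) (K - j))"
      by (simp add: A_def fps_sum_nth)
    \<comment> \<open>The terms beyond \<open>K - j\<close> are divisible by a higher power of \<open>X\<close>, and \<open>K - j < 2 N\<close>.\<close>
    also have "\<dots> = (\<Sum>i\<le>K - j. fps_nth (q_fact q i) (K - j))"
      using KN by (intro sum.mono_neutral_right) (auto intro: q_fact_nth_eq_0[OF q0])
    also have "\<dots> = fishburn r (K - j)"
      using kontsevich_F_nth[OF q0] by (simp add: fishburn_def q_def)
    finally show "(-1) ^ j * int (s choose j) * fps_nth A (K - j) = int (s choose j) * (-1) ^ j * fishburn r (K - j)"
      by simp
  qed simp
  finally show ?thesis by (simp add: K_def cong_0_iff)
qed

end
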